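(* Let $(X,d)$ be an ultrametric space with at least two points and let $S$ be a metric basis of $(X,d)$. If $d'$ is any other ultrametric on $X$ such that $d'(x,s)=d(x,s)$ for all $x\in X$ and $s\in S$, then $d=d'$. Moreover, for any $x,y\in X$ and any $s\in S$ that distinguishes $x,y$, $d(x,y)=\max\{d(x,s),d(y,s)\}$.
   Context: A metric space $(X,d)$ is ultrametric if $d(x,y)\le\max\{d(x,z),d(z,y)\}$ for all $x,y,z\in X$. Points $x,y\in X$ are distinguished by $z\in X$ if $d(x,z)\neq d(y,z)$. A set $S\subseteq X$ is a metric generator for $X$ if any pair of different points of $X$ is distinguished by at least one element of $S$. A metric basis is a metric generator of minimum cardinality in $X$. *)

theory Defs
  imports "HOL-Analysis.Analysis" "HOL-Library.Equipollence"
begin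

locale Ultrametric_space = Metric_space +
  assumes ultra: "\<lbrakk>x \<in> M; y \<in> M; z \<in> M\<rbrakk> \<Longrightarrow> d x y \<le> max (d x z) (d z y)"

context Metric_space
begin

definition distinguishes :: "'a \<Rightarrow> 'a \<Rightarrow> 'a \<Rightarrow> bool" where
  "distinguishes z x y \<longleftrightarrow> d x z \<noteq> d y z"

definition metric_generator :: "'a set \<Rightarrow> bool" where
  "metric_generator S \<longleftrightarrow>
     S \<subseteq> M \<and> (\<forall>x\<in>M. \<forall>y\<in>M. x \<noteq> y \<longrightarrow> (\<exists>s\<in>S. distinguishes s x y))"

(* Cardinalities are compared by injections, so that infinite spaces are treated correctly. *)
definition metric_basis :: "'a set \<Rightarrow> bool" where
  "metric_basis S \<longleftrightarrow> metric_generator S \<and> (\<forall>T. metric_generator T \<longrightarrow> S \<lesssim> T)"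

end

end

theory Submission
  imports Defs
begin

text \<open>
  In an ultrametric space every triangle is isosceles with its two longest sides equal. If \<open>s\<close>
  distinguishes \<open>x\<close> and \<open>y\<close>, then the sides from \<open>s\<close> have different lengths, so the longer of
  them cannot be the only longest side, and \<open>d x y\<close> must equal it. Thus \<open>d x y\<close> can be computed
  from distances to \<open>s\<close> alone. Every two different points are distinguished by an element of a
  metric generator \<open>S\<close>, so the distances to \<open>S\<close> determine the ultrametric: an ultrametric
  \<open>d'\<close> that agrees with \<open>d\<close> on them makes the same elements of \<open>S\<close> distinguish the same points,
  and the same formula computes both distances.
\<close>

lemma (in Ultrametric_space) dist_eq_max_if_distinguishes:
  assumes "x \<in> M" "y \<in> M" "s \<in> M" "distinguishes s x y"
  shows "d x y = max (d x s) (d y s)"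
proof -
  have "d x y \<le> max (d x s) (d y s)"
    using ultra[of x y s] assms by (simp add: commute)
  moreover have "d x s \<le> max (d x y) (d y s)" "d y s \<le> max (d x y) (d x s)"
    using ultra[of x s y] ultra[of y s x] assms by (simp_all add: commute)
  ultimately show ?thesis
    using assms(4) unfolding distinguishes_def by linarith
qed

lemma ultrametric_determined_by_metric_generator:
  assumes d: "Ultrametric_space X d" and d': "Ultrametric_space X d'"
    and gen: "Metric_space.metric_generator X d S"
    and agree: "\<And>x s. \<lbrakk>x \<in> X; s \<in> S\<rbrakk> \<Longrightarrow> d' x s = d x s"
    and xy: "x \<in> X" "y \<in> X"
  shows "d x y = d' x y"
proof -
  interpret D: Ultrametric_space X d by fact
  interpret D': Ultrametric_space X d' by fact
  show ?thesis
  proof (cases "x = y")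
    case True
    then show ?thesis using xy by simp
  next
    case False
    then obtain s where s: "s \<in> S" "s \<in> X" "D.distinguishes s x y"
      using gen xy unfolding D.metric_generator_def by blast
    then have "D'.distinguishes s x y"
      using agree xy by (simp add: D.distinguishes_def D'.distinguishes_def)
    then show ?thesis
      using s xy agree D.dist_eq_max_if_distinguishes D'.dist_eq_max_if_distinguishes by simp
  qed
qed

theorem theorem2p43:
  fixes X S :: "'a set" and d :: "'a \<Rightarrow> 'a \<Rightarrow> real"
  assumes "Ultrametric_space X d"
    and "\<exists>x\<in>X. \<exists>y\<in>X. x \<noteq> y"
    and "Metric_space.metric_basis X d S"
  shows "(\<forall>d'. Ultrametric_space X d' \<and> (\<forall>x\<in>X. \<forall>s\<in>S. d' x s = d x s)
             \<longrightarrow> (\<forall>x\<in>X. \<forall>y\<in>X. d x y = d' x y)) \<and>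
         (\<forall>x\<in>X. \<forall>y\<in>X. \<forall>s\<in>S. Metric_space.distinguishes d s x y
             \<longrightarrow> d x y = max (d x s) (d y s))"
proof -
  interpret Ultrametric_space X d by fact
  have gen: "metric_generator S"
    using assms(3) unfolding metric_basis_def by blast
  then have "S \<subseteq> X"
    unfolding metric_generator_def by blast
  then show ?thesis
    using ultrametric_determined_by_metric_generator[OF assms(1) _ gen]
      dist_eq_max_if_distinguishes by blast
qed

end
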